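(* There is an absolute constant $C>0$ such that the following holds. Let $n\ge 1$ be an integer, let $R=\{r_1,\dots,r_n\}$ be a set of $n$ regions, let $\mathcal{M}\in\mathbb{R}^{n\times n}$ be a similarity matrix on $R$, and let $G$ be any region connected graph on the vertex set $R$ produced from $\mathcal{M}$ by the construction described in the context. Then every node of $G$ has degree at most $C\sqrt{n}$ (that is, the degree of any node is $O(\sqrt{n})$), and the graph distance in $G$ between any two nodes is at most $2$.
   Context: Let $R=\{r_1,\dots,r_n\}$ be a set of $n$ regions (the vertices), and let $\mathcal{M}\in\mathbb{R}^{n\times n}$ be a similarity matrix, where $\mathcal{M}_{i,j}$ is the similarity between $r_i$ and $r_j$ (any similarity measure is allowed). Write $s=\lfloor\sqrt{n}\rfloor$. The region connected graph $G$ is the simple undirected graph on $R$ constructed as follows. All selections are made without replacement, so the regions named below in steps 1, 2 and 4(a) are pairwise distinct; ties are broken arbitrarily. 1. Select the $s$ regions with the largest sum of similarity with the other regions; denote them $r_{1,1},\dots,r_{1,s}$. 2. For each $i\in\{1,\dots,s\}$ (one after another), select, among the regions not yet selected, $s-1$ regions having the largest similarity with $r_{1,i}$; denote them $r_{2,i,1},\dots,r_{2,i,s-1}$. Connect $r_{1,i}$ by an edge to $r_{2,i,j}$ for every $j\in\{1,\dots,s-1\}$. 3. Connect each $r_{2,i,j}$ by an edge to $r_{2,i,k}$ for all $k\in\{1,\dots,s-1\}\setminus\{j\}$, and to $r_{2,u,j}$ for all $u\in\{1,\dots,s\}\setminus\{i\}$. 4. (a) If $\sqrt{n}\notin\mathbb{Z}$,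 denote the remaining $n-s^2$ unselected regions by $r_{3,1},\dots,r_{3,n-s^2}$, and connect each of them by an edge to $r_{1,i}$ for every $i\in\{1,\dots,s\}$. (b) If $\sqrt{n}\in\mathbb{Z}$, choose an arbitrary (random) index $i\in\{1,\dots,s\}$ and connect $r^{*}:=r_{1,i}$ by an edge to $r_{1,j}$ for every $j\in\{1,\dots,s\}\setminus\{i\}$. There are no other edges. The distance between two nodes is the number of edges in a shortest path joining them. *)

theory Defs
  imports "HOL-Analysis.Analysis" "Jordan_Normal_Form.Matrix" "Graph_Theory.Graph_Theory"
begin

(* The regions are identified with the row/column indices 0, ..., n - 1 of the similarity
   matrix.  A concrete vertex type is used on purpose: for a polymorphic vertex type, a constant
   C quantified inside the theorem could depend on the type instance, hence on n. *)

text \<open>\<open>x 1, \<dots>, x k\<close> lists, in any order, \<open>k\<close> distinct elements of \<open>A\<close> with the largest values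
  of \<open>f\<close>; ties are broken arbitrarily.\<close>

definition top_selection :: "'a set \<Rightarrow> ('a \<Rightarrow> real) \<Rightarrow> nat \<Rightarrow> (nat \<Rightarrow> 'a) \<Rightarrow> bool" where
  "top_selection A f k x \<longleftrightarrow>
     inj_on x {1..k} \<and> x ` {1..k} \<subseteq> A \<and>
     (\<forall>j\<in>{1..k}. \<forall>v\<in>A - x ` {1..k}. f v \<le> f (x j))"

definition total_similarity :: "nat \<Rightarrow> real mat \<Rightarrow> nat \<Rightarrow> real" where
  "total_similarity n M v = (\<Sum>u\<in>{..<n} - {v}. M $$ (v, u))"

text \<open>The regions not yet selected when the second step reaches index \<open>i\<close>.  For \<open>i = s + 1\<close> these
  are the regions left over after the second step.\<close>

definition unselected :: "nat \<Rightarrow> nat \<Rightarrow> (nat \<Rightarrow> nat) \<Rightarrow> (nat \<Rightarrow> nat \<Rightarrow> nat) \<Rightarrow> nat \<Rightarrow> nat set" where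
  "unselected n s r1 r2 i = {..<n} - r1 ` {1..s} - (\<Union>k\<in>{1..<i}. r2 k ` {1..s-1})"

definition valid_selection ::
    "nat \<Rightarrow> real mat \<Rightarrow> nat \<Rightarrow> (nat \<Rightarrow> nat) \<Rightarrow> (nat \<Rightarrow> nat \<Rightarrow> nat) \<Rightarrow> bool" where
  "valid_selection n M s r1 r2 \<longleftrightarrow>
     top_selection {..<n} (total_similarity n M) s r1 \<and>
     (\<forall>i\<in>{1..s}. top_selection (unselected n s r1 r2 i) (\<lambda>v. M $$ (r1 i, v)) (s - 1) (r2 i))"

text \<open>Every edge is listed in at least one orientation; \<open>c\<close> is the index of \<open>r\<^sup>*\<close>.\<close>

definition rcg_edges ::
    "nat \<Rightarrow> nat \<Rightarrow> (nat \<Rightarrow> nat) \<Rightarrow> (nat \<Rightarrow> nat \<Rightarrow> nat) \<Rightarrow> nat \<Rightarrow> (nat \<times> nat) set" where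
  "rcg_edges n s r1 r2 c =
     {(r1 i, r2 i j) | i j. i \<in> {1..s} \<and> j \<in> {1..s-1}} \<union>
     {(r2 i j, r2 i k) | i j k. i \<in> {1..s} \<and> j \<in> {1..s-1} \<and> k \<in> {1..s-1} - {j}} \<union>
     {(r2 i j, r2 u j) | i j u. i \<in> {1..s} \<and> j \<in> {1..s-1} \<and> u \<in> {1..s} - {i}} \<union>
     (if sqrt (real n) \<notin> \<int>
      then {(v, r1 i) | v i. v \<in> unselected n s r1 r2 (s + 1) \<and> i \<in> {1..s}}
      else {(r1 c, r1 j) | j. j \<in> {1..s} - {c}})"

text \<open>A simple undirected graph is represented as a symmetric loop-free digraph, the notion
  \<^locale>\<open>pair_graph\<close>; a vertex's number of incident edges is then its out-degree.\<close>

definition region_connected_graph :: "nat \<Rightarrow> real mat \<Rightarrow> nat pair_pre_digraph \<Rightarrow> bool" where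
  "region_connected_graph n M G \<longleftrightarrow>
     (let s = nat \<lfloor>sqrt (real n)\<rfloor> in
      \<exists>r1 r2 c. valid_selection n M s r1 r2 \<and> c \<in> {1..s} \<and>
        pverts G = {..<n} \<and>
        parcs G = rcg_edges n s r1 r2 c \<union> (rcg_edges n s r1 r2 c)\<inverse>)"

definition graph_distance :: "'a pair_pre_digraph \<Rightarrow> 'a \<Rightarrow> 'a \<Rightarrow> ereal" where
  "graph_distance G u v = wf_digraph.\<mu> (with_proj G) (\<lambda>_. 1) u v"

lemma valid_selectionD:
  assumes "valid_selection n M s r1 r2"
  shows "inj_on r1 {1..s}"
    and "i \<in> {1..s} \<Longrightarrow> r1 i < n"
    and "i \<in> {1..s} \<Longrightarrow> inj_on (r2 i) {1..s-1}"
    and "i \<in> {1..s} \<Longrightarrow> j \<in> {1..s-1} \<Longrightarrow> r2 i j < n"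
    and "i \<in> {1..s} \<Longrightarrow> j \<in> {1..s-1} \<Longrightarrow> k \<in> {1..s} \<Longrightarrow> r2 i j \<noteq> r1 k"
    and "i \<in> {1..s} \<Longrightarrow> j \<in> {1..s-1} \<Longrightarrow> k \<in> {1..s} \<Longrightarrow> l \<in> {1..s-1} \<Longrightarrow> i \<noteq> k \<Longrightarrow>
      r2 i j \<noteq> r2 k l"
proof -
  have top1: "top_selection {..<n} (total_similarity n M) s r1"
    and top2: "\<And>i. i \<in> {1..s} \<Longrightarrow>
      top_selection (unselected n s r1 r2 i) (\<lambda>v. M $$ (r1 i, v)) (s - 1) (r2 i)"
    using assms by (auto simp: valid_selection_def)
  show "inj_on r1 {1..s}" using top1 by (simp add: top_selection_def)
  show "r1 i < n" if "i \<in> {1..s}" using top1 that unfolding top_selection_def by blast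
  show "inj_on (r2 i) {1..s-1}" if "i \<in> {1..s}"
    using top2[OF that] by (simp add: top_selection_def)
  have mem: "r2 i j \<in> unselected n s r1 r2 i" if "i \<in> {1..s}" "j \<in> {1..s-1}" for i j
    using top2[OF that(1)] that(2) unfolding top_selection_def by blast
  show "r2 i j < n" if "i \<in> {1..s}" "j \<in> {1..s-1}"
    using mem[OF that] by (simp add: unselected_def)
  show "r2 i j \<noteq> r1 k" if "i \<in> {1..s}" "j \<in> {1..s-1}" "k \<in> {1..s}"
    using mem[OF that(1,2)] that(3) unfolding unselected_def by blast
  have less: "r2 i j \<noteq> r2 k l"
    if "i \<in> {1..s}" "j \<in> {1..s-1}" "k \<in> {1..s}" "l \<in> {1..s-1}" "k < i" for i j k l
  proof -
    have "k \<in> {1..<i}" using that by simp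
    then show ?thesis using mem[OF that(1,2)] that(4) unfolding unselected_def by blast
  qed
  show "r2 i j \<noteq> r2 k l"
    if "i \<in> {1..s}" "j \<in> {1..s-1}" "k \<in> {1..s}" "l \<in> {1..s-1}" "i \<noteq> k"
    using less[of i j k l] less[of k l i j] that by (metis linorder_neqE_nat)
qed

lemma rcg_edges_wf:
  assumes sel: "valid_selection n M s r1 r2" and c: "c \<in> {1..s}"
    and e: "(u, v) \<in> rcg_edges n s r1 r2 c"
  shows "u < n \<and> v < n \<and> u \<noteq> v"
proof -
  note D = valid_selectionD[OF sel]
  have un: "v < n \<and> (\<forall>i\<in>{1..s}. v \<noteq> r1 i)" if "v \<in> unselected n s r1 r2 (s + 1)" for v
    using that by (auto simp: unselected_def)
  have inj1: "r1 i \<noteq> r1 j" if "i \<in> {1..s}" "j \<in> {1..s}" "i \<noteq> j" for i j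
    using D(1) that by (meson inj_onD)
  have inj2: "r2 i j \<noteq> r2 i k" if "i \<in> {1..s}" "j \<in> {1..s-1}" "k \<in> {1..s-1}" "j \<noteq> k" for i j k
    using D(3)[OF that(1)] that by (meson inj_onD)
  from e consider
      (a) i j where "u = r1 i" "v = r2 i j" "i \<in> {1..s}" "j \<in> {1..s-1}"
    | (b) i j k where "u = r2 i j" "v = r2 i k" "i \<in> {1..s}" "j \<in> {1..s-1}" "k \<in> {1..s-1}" "j \<noteq> k"
    | (d) i j k where "u = r2 i j" "v = r2 k j" "i \<in> {1..s}" "j \<in> {1..s-1}" "k \<in> {1..s}" "i \<noteq> k"
    | (f) i where "u \<in> unselected n s r1 r2 (s + 1)" "v = r1 i" "i \<in> {1..s}"
    | (g) j where "u = r1 c" "v = r1 j" "j \<in> {1..s}" "j \<noteq> c"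
    unfolding rcg_edges_def by (simp split: if_splits) blast+
  then show ?thesis
  proof cases
    case a then show ?thesis using D(2,4) D(5)[of i j i] by metis
  next
    case b then show ?thesis using D(4) inj2 by metis
  next
    case d then show ?thesis using D(4) D(6)[of i j k j] by metis
  next
    case f then show ?thesis using D(2) un by metis
  next
    case g then show ?thesis using D(2) inj1 c by metis
  qed
qed

lemma region_connected_graph_pair_graph:
  assumes "region_connected_graph n M G"
  shows "pair_graph G"
proof -
  obtain s r1 r2 c where sel: "valid_selection n M s r1 r2" and c: "c \<in> {1..s}"
    and V: "pverts G = {..<n}"
    and E: "parcs G = rcg_edges n s r1 r2 c \<union> (rcg_edges n s r1 r2 c)\<inverse>"
    using assms by (auto simp: region_connected_graph_def Let_def)
  have wf: "u < n \<and> v < n \<and> u \<noteq> v" if "(u, v) \<in> parcs G" for u v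
    using that rcg_edges_wf[OF sel c] unfolding E by blast
  have "parcs G \<subseteq> {..<n} \<times> {..<n}" using wf by auto
  then have fin: "finite (parcs G)" by (rule finite_subset) simp
  have sym: "symmetric (with_proj G)"
    unfolding symmetric_def sym_def by (auto simp: arcs_ends_def arc_to_ends_def E)
  show ?thesis
    using wf fin V sym by unfold_locales force+
qed

end

theory Submission
  imports Defs
begin

text \<open>Every region lies in exactly one of three classes: the hubs \<open>r1 i\<close>, the \<open>s(s - 1)\<close> regions
  \<open>r2 i j\<close>, and \<open>n - s\<^sup>2 \<le> 2s\<close> leftover regions, so each neighbourhood is a union of boundedly many
  sets of size \<open>O(s)\<close>.  Two vertices that are not adjacent have a common neighbour: \<open>r2 i k\<close> for
  \<open>r2 i j\<close> and \<open>r2 u k\<close>, \<open>r2 i j\<close> for \<open>r1 i\<close> and \<open>r2 u j\<close>, a leftover region or \<open>r\<^sup>*\<close> for two hubs,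
  and a hub whenever a leftover region is involved.\<close>

section \<open>Distances bounded by explicit walks\<close>

text \<open>The distance is an infimum of walk costs, so a single walk with at most two arcs
  suffices, and no shortest path has to be determined.\<close>

lemma graph_distance_le_2:
  assumes "wf_digraph (with_proj G)" and "u \<in> pverts G"
    and "u = v \<or> (u, v) \<in> parcs G \<or> (\<exists>w. (u, w) \<in> parcs G \<and> (w, v) \<in> parcs G)"
  shows "graph_distance G u v \<le> 2"
proof -
  interpret wf_digraph "with_proj G" by fact
  have V: "x \<in> pverts G" "y \<in> pverts G" if "(x, y) \<in> parcs G" for x y
    using wellformed[of "(x, y)"] that by simp_all
  have "\<exists>p. awalk u p v \<and> length p \<le> 2"
    using assms(3)
  proof (elim disjE exE conjE)
    assume "u = v"
    then show ?thesis using assms(2) by (intro exI[of _ "[]"]) (simp add: awalk_Nil_iff)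
  next
    assume uv: "(u, v) \<in> parcs G"
    show ?thesis
      using uv V[OF uv] by (intro exI[of _ "[(u, v)]"]) (simp add: awalk_Cons_iff awalk_Nil_iff)
  next
    fix w assume uw: "(u, w) \<in> parcs G" and wv: "(w, v) \<in> parcs G"
    show ?thesis using uw wv V[OF wv]
      by (intro exI[of _ "[(u, w), (w, v)]"]) (simp add: awalk_Cons_iff awalk_Nil_iff)
  qed
  then obtain p where p: "awalk u p v" "length p \<le> 2" by blast
  have "awalk_cost (\<lambda>_. 1) p = length p"
    by (simp add: awalk_cost_def sum_list_triv)
  with p(2) have "ereal (awalk_cost (\<lambda>_. 1) p) \<le> 2"
    by simp
  with min_cost_le_walk_cost[OF p(1)] show ?thesis
    unfolding graph_distance_def by (rule order_trans)
qed

section \<open>The integer square root\<close>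

text \<open>Links the two ways of telling the cases apart: the construction branches on integrality
  of the root, whereas counting vertices compares \<open>n\<close> with
  \<open>s\<^sup>2\<close>.\<close>

lemma sqrt_Ints_iff_square:
  "sqrt (real n) \<in> \<int> \<longleftrightarrow> n = (nat \<lfloor>sqrt (real n)\<rfloor>)\<^sup>2"
proof
  let ?s = "nat \<lfloor>sqrt (real n)\<rfloor>"
  assume "sqrt (real n) \<in> \<int>"
  then have "real ?s = sqrt (real n)"
    by (auto elim!: Ints_cases)
  then have "(real ?s)\<^sup>2 = (sqrt (real n))\<^sup>2"
    by (rule arg_cong)
  then have "real (?s\<^sup>2) = real n"
    unfolding of_nat_power by (simp only: real_sqrt_pow2 of_nat_0_le_iff)
  then show "n = ?s\<^sup>2" by linarith
next
  let ?s = "nat \<lfloor>sqrt (real n)\<rfloor>"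
  assume "n = ?s\<^sup>2"
  then have "real n = (real ?s)\<^sup>2" unfolding of_nat_power[symmetric] by (rule arg_cong)
  then have "sqrt (real n) = real ?s" by (rule real_sqrt_unique[OF sym]) simp
  then show "sqrt (real n) \<in> \<int>" by (rule ssubst) (rule Ints_of_nat)
qed

lemma floor_sqrt_bounds:
  assumes "s = nat \<lfloor>sqrt (real n)\<rfloor>"
  shows "real s \<le> sqrt (real n)" and "s\<^sup>2 \<le> n" and "n \<le> s\<^sup>2 + 2 * s"
proof -
  show "real s \<le> sqrt (real n)" using assms by simp
  then have "(real s)\<^sup>2 \<le> (sqrt (real n))\<^sup>2" by (rule power_mono) simp
  then have "real (s\<^sup>2) \<le> real n" by simp
  then show "s\<^sup>2 \<le> n" by (rule of_nat_le_iff[THEN iffD1])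
  \<comment> \<open>Strictness matters: over the integers, \<open>n < (s + 1)\<^sup>2\<close> gives
    the bound \<open>2 * s\<close> on the number of leftover regions.\<close>
  have "sqrt (real n) < real (s + 1)" using assms by linarith
  then have "(sqrt (real n))\<^sup>2 < (real (s + 1))\<^sup>2" by (rule power_strict_mono) simp_all
  then have "real n < real ((s + 1)\<^sup>2)" by simp
  then have "n < (s + 1)\<^sup>2" by (rule of_nat_less_iff[THEN iffD1])
  then show "n \<le> s\<^sup>2 + 2 * s" by (simp add: power2_eq_square)
qed

section \<open>One run of the construction: vertex classes and arcs\<close>

locale rcg_construction =
  fixes n s c :: nat and M :: "real mat" and r1 :: "nat \<Rightarrow> nat" and r2 :: "nat \<Rightarrow> nat \<Rightarrow> nat"
    and G :: "nat pair_pre_digraph"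
  assumes s: "s = nat \<lfloor>sqrt (real n)\<rfloor>"
    and sel: "valid_selection n M s r1 r2"
    and c: "c \<in> {1..s}"
    and verts: "pverts G = {..<n}"
    and arcs: "parcs G = rcg_edges n s r1 r2 c \<union> (rcg_edges n s r1 r2 c)\<inverse>"
begin

abbreviation "leftover \<equiv> unselected n s r1 r2 (s + 1)"

lemma wf: "wf_digraph (with_proj G)"
proof -
  have "region_connected_graph n M G"
    unfolding region_connected_graph_def Let_def s[symmetric] using sel c verts arcs by blast
  then interpret pair_graph G by (rule region_connected_graph_pair_graph)
  show ?thesis by unfold_locales
qed

lemma leftover_eq: "leftover = {..<n} - (r1 ` {1..s} \<union> (\<Union>k\<in>{1..s}. r2 k ` {1..s-1}))"
proof -
  \<comment> \<open>At index \<open>s + 1\<close> the half-open range covers all \<open>s\<close>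
    rounds of the second selection.\<close>
  have "{1..<s + 1} = {1..s}" by auto
  then show ?thesis unfolding unselected_def by blast
qed

lemma vertex_cases:
  assumes "v \<in> pverts G"
  obtains (hub) i where "v = r1 i" "i \<in> {1..s}"
    | (grid) i j where "v = r2 i j" "i \<in> {1..s}" "j \<in> {1..s-1}"
    | (leftover) "v \<in> leftover"
proof -
  show thesis using that assms unfolding leftover_eq verts by blast
qed

lemma arc_iff:
  "(u, v) \<in> parcs G \<longleftrightarrow> (u, v) \<in> rcg_edges n s r1 r2 c \<or> (v, u) \<in> rcg_edges n s r1 r2 c"
  by (auto simp: arcs)

lemma arc_sym: "(u, v) \<in> parcs G \<Longrightarrow> (v, u) \<in> parcs G"
  by (auto simp: arc_iff)

lemma arc_hub_grid: "i \<in> {1..s} \<Longrightarrow> j \<in> {1..s-1} \<Longrightarrow> (r1 i, r2 i j) \<in> parcs G"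
  unfolding arcs rcg_edges_def by blast

lemma arc_row:
  "i \<in> {1..s} \<Longrightarrow> j \<in> {1..s-1} \<Longrightarrow> k \<in> {1..s-1} \<Longrightarrow> j \<noteq> k \<Longrightarrow> (r2 i j, r2 i k) \<in> parcs G"
  unfolding arcs rcg_edges_def by blast

lemma arc_column:
  "i \<in> {1..s} \<Longrightarrow> u \<in> {1..s} \<Longrightarrow> j \<in> {1..s-1} \<Longrightarrow> i \<noteq> u \<Longrightarrow> (r2 i j, r2 u j) \<in> parcs G"
  unfolding arcs rcg_edges_def by blast

text \<open>Selection without replacement makes the hubs and the \<open>s\<close> rows of
  \<open>s - 1\<close> regions disjoint, so they use up \<open>s + s * (s - 1) = s\<^sup>2\<close>
  vertices.\<close>

lemma card_leftover: "card leftover = n - s\<^sup>2"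
proof -
  note D = valid_selectionD[OF sel]
  let ?R1 = "r1 ` {1..s}" and ?R2 = "\<Union>k\<in>{1..s}. r2 k ` {1..s-1}"
  have R1: "card ?R1 = s" using card_image[OF D(1)] by simp
  have "card ?R2 = (\<Sum>k\<in>{1..s}. card (r2 k ` {1..s-1}))"
  proof (rule card_UN_disjoint)
    show "\<forall>i\<in>{1..s}. \<forall>j\<in>{1..s}. i \<noteq> j \<longrightarrow> r2 i ` {1..s-1} \<inter> r2 j ` {1..s-1} = {}"
    proof (intro ballI impI equals0I)
      fix i j v assume ij: "i \<in> {1..s}" "j \<in> {1..s}" "i \<noteq> j"
        and "v \<in> r2 i ` {1..s-1} \<inter> r2 j ` {1..s-1}"
      then obtain k l where "k \<in> {1..s-1}" "l \<in> {1..s-1}" "r2 i k = r2 j l" by blast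
      with D(6)[of i k j l] ij show False by simp
    qed
  qed simp_all
  also have "\<dots> = (\<Sum>k\<in>{1..s}. s - 1)"
  proof (rule sum.cong)
    fix k assume "k \<in> {1..s}"
    from card_image[OF D(3)[OF this]] show "card (r2 k ` {1..s-1}) = s - 1" by simp
  qed simp
  finally have R2: "card ?R2 = s * (s - 1)" by simp
  have disj: "?R1 \<inter> ?R2 = {}"
  proof (rule Int_emptyI)
    fix v assume "v \<in> ?R1" "v \<in> ?R2"
    from \<open>v \<in> ?R1\<close> obtain i where i: "i \<in> {1..s}" "v = r1 i" by blast
    from \<open>v \<in> ?R2\<close> obtain k where k: "k \<in> {1..s}" "v \<in> r2 k ` {1..s-1}" by blast
    from k(2) obtain l where l: "l \<in> {1..s-1}" "v = r2 k l" by blast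
    from D(5)[OF k(1) l(1) i(1)] show False unfolding i(2)[symmetric] l(2)[symmetric] by simp
  qed
  have "card (?R1 \<union> ?R2) = s + s * (s - 1)"
    using card_Un_disjoint[OF _ _ disj] R1 R2 by simp
  also have "\<dots> = s\<^sup>2" by (cases s) (simp_all add: power2_eq_square)
  finally have card: "card (?R1 \<union> ?R2) = s\<^sup>2" .
  have "?R1 \<union> ?R2 \<subseteq> {..<n}"
    using D(2,4) by (intro Un_least UN_least image_subsetI) simp_all
  then have "card leftover = card {..<n} - card (?R1 \<union> ?R2)"
    unfolding leftover_eq by (intro card_Diff_subset) (simp_all add: finite_UN)
  then show ?thesis unfolding card by simp
qed

section \<open>Common neighbours\<close>

text \<open>These arcs are built only if the root is not an integer; the mere existence of
  \<open>v\<close> forces \<open>n \<noteq> s\<^sup>2\<close> and hence that branch.\<close>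

lemma arc_leftover_hub:
  assumes "v \<in> leftover" "i \<in> {1..s}"
  shows "(v, r1 i) \<in> parcs G"
proof -
  have "finite leftover" by (simp add: unselected_def)
  with assms(1) have "card leftover > 0" by (auto simp: card_gt_0_iff)
  then have "n \<noteq> s\<^sup>2" unfolding card_leftover by simp
  then have "sqrt (real n) \<notin> \<int>" unfolding sqrt_Ints_iff_square s[symmetric] .
  moreover have "(v, r1 i) \<in> {(v, r1 i) | v i. v \<in> leftover \<and> i \<in> {1..s}}"
    using assms by blast
  ultimately show ?thesis unfolding arcs rcg_edges_def by (simp only: if_True simp_thms Un_iff)
qed

lemma hubs_joined:
  assumes "i \<in> {1..s}" "j \<in> {1..s}"
  shows "r1 i = r1 j \<or> (r1 i, r1 j) \<in> parcs G \<or>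
    (\<exists>w. (r1 i, w) \<in> parcs G \<and> (w, r1 j) \<in> parcs G)"
proof (cases "sqrt (real n) \<in> \<int>")
  case True
  have star: "(r1 c, r1 k) \<in> parcs G" if "k \<in> {1..s}" "k \<noteq> c" for k
  proof -
    have "(r1 c, r1 k) \<in> {(r1 c, r1 j) | j. j \<in> {1..s} - {c}}" using that by blast
    then show ?thesis unfolding arcs rcg_edges_def
      by (simp only: Un_iff True not_True_eq_False if_False simp_thms)
  qed
  show ?thesis
  proof (cases "i = c \<or> j = c")
    case True
    then show ?thesis using star[OF assms(1)] star[OF assms(2)] arc_sym[of "r1 c" "r1 i"] by blast
  next
    case False
    then show ?thesis using star[OF assms(1), THEN arc_sym] star[OF assms(2)] by blast
  qed
next
  case False
  then have "n \<noteq> s\<^sup>2" unfolding sqrt_Ints_iff_square s[symmetric] .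
  \<comment> \<open>Subtraction truncates, so \<open>s\<^sup>2 \<le> n\<close> is needed to make
    \<open>n - s\<^sup>2\<close> positive.\<close>
  then have "card leftover \<noteq> 0"
    unfolding card_leftover using floor_sqrt_bounds(2)[OF s] by linarith
  then obtain w where "w \<in> leftover" by fastforce
  from arc_leftover_hub[OF this] show ?thesis using assms arc_sym[of w "r1 i"] by blast
qed

lemma hub_grid_joined:
  assumes "i \<in> {1..s}" "u \<in> {1..s}" "j \<in> {1..s-1}"
  shows "(r1 i, r2 u j) \<in> parcs G \<or> (\<exists>w. (r1 i, w) \<in> parcs G \<and> (w, r2 u j) \<in> parcs G)"
  using assms arc_hub_grid[of i j] arc_column[of i u j] by (cases "i = u") blast+

lemma vertices_joined:
  assumes "u \<in> pverts G" "v \<in> pverts G"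
  shows "u = v \<or> (u, v) \<in> parcs G \<or> (\<exists>w. (u, w) \<in> parcs G \<and> (w, v) \<in> parcs G)"
  (is "?J u v")
proof -
  \<comment> \<open>Both orders are recorded so that a leftover region can be handled as either
    end.\<close>
  have left: "?J x y" "?J y x" if x: "x \<in> leftover" and y: "y \<in> pverts G" for x y
  proof -
    from y consider "(x, y) \<in> parcs G" | w where "(x, w) \<in> parcs G" "(w, y) \<in> parcs G"
    proof (cases rule: vertex_cases)
      case (hub i)
      then show thesis using that(1) arc_leftover_hub[OF x hub(2)] by simp
    next
      case (grid i j)
      then show thesis using that(2) arc_leftover_hub[OF x grid(2)] arc_hub_grid[OF grid(2,3)] by simp
    next
      case leftover
      \<comment> \<open>Every hub joins two leftover regions; \<open>r1 c\<close> serves as one that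
        certainly exists.\<close>
      then show thesis
        using that(2) arc_leftover_hub[OF x c] arc_sym[OF arc_leftover_hub[OF leftover c]] by simp
    qed
    then show "?J x y" "?J y x" using arc_sym by (cases; blast)+
  qed
  from assms(1) show ?thesis
  proof (cases rule: vertex_cases)
    case u: (hub i)
    from assms(2) show ?thesis
    proof (cases rule: vertex_cases)
      case (hub j)
      then show ?thesis using u hubs_joined[of i j] by simp
    next
      case (grid k j)
      then show ?thesis using u hub_grid_joined[of i k j] by simp
    qed (rule left(2)[OF _ assms(1)])
  next
    case u: (grid i j)
    from assms(2) show ?thesis
    proof (cases rule: vertex_cases)
      case (hub k)
      with u consider "(v, u) \<in> parcs G" | w where "(v, w) \<in> parcs G" "(w, u) \<in> parcs G"
        using hub_grid_joined[of k i j] by blast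
      then show ?thesis using arc_sym by (cases; blast)
    next
      case v: (grid k l)
      \<comment> \<open>If both indices differ, the corner \<open>r2 i l\<close> is the middle
        vertex; otherwise the two vertices are equal or adjacent.\<close>
      show ?thesis
        using arc_row[of i j l] arc_column[of i k l] arc_column[of i k j] u v
        by (cases "i = k"; cases "j = l"; blast)
    qed (rule left(2)[OF _ assms(1)])
  qed (rule left(1)[OF _ assms(2)])
qed

section \<open>Neighbourhoods\<close>

text \<open>Index inequalities, the integrality condition and the star centre are forgotten:
  bounding neighbourhoods from above only requires the classes and indices of the two ends.\<close>

lemma rcg_edge_cases:
  assumes "(u, v) \<in> rcg_edges n s r1 r2 c"
  obtains (hub_grid) i j where "u = r1 i" "v = r2 i j" "i \<in> {1..s}" "j \<in> {1..s-1}"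
    | (row) i j k where "u = r2 i j" "v = r2 i k" "i \<in> {1..s}" "j \<in> {1..s-1}" "k \<in> {1..s-1}"
    | (column) i j k where "u = r2 i j" "v = r2 k j" "i \<in> {1..s}" "k \<in> {1..s}" "j \<in> {1..s-1}"
    | (leftover_hub) i where "u \<in> leftover" "v = r1 i" "i \<in> {1..s}"
    | (hubs) i j where "u = r1 i" "v = r1 j" "i \<in> {1..s}" "j \<in> {1..s}"
  using assms c unfolding rcg_edges_def by (simp split: if_splits) blast+

text \<open>Reversal preserves the shape of the row, column and hub-hub families, so only the other
  two families split in two.\<close>

lemma arc_cases:
  assumes "(u, v) \<in> parcs G"
  obtains (hub_grid) i j where "u = r1 i" "v = r2 i j" "i \<in> {1..s}" "j \<in> {1..s-1}"
    | (grid_hub) i j where "u = r2 i j" "v = r1 i" "i \<in> {1..s}" "j \<in> {1..s-1}"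
    | (row) i j k where "u = r2 i j" "v = r2 i k" "i \<in> {1..s}" "j \<in> {1..s-1}" "k \<in> {1..s-1}"
    | (column) i j k where "u = r2 i j" "v = r2 k j" "i \<in> {1..s}" "k \<in> {1..s}" "j \<in> {1..s-1}"
    | (hub_leftover) i where "u = r1 i" "v \<in> leftover" "i \<in> {1..s}"
    | (leftover_hub) i where "u \<in> leftover" "v = r1 i" "i \<in> {1..s}"
    | (hubs) i j where "u = r1 i" "v = r1 j" "i \<in> {1..s}" "j \<in> {1..s}"
  using assms unfolding arc_iff
proof
  assume "(u, v) \<in> rcg_edges n s r1 r2 c"
  then show thesis using that(1,3,4,6,7) by (cases rule: rcg_edge_cases) metis+
next
  assume "(v, u) \<in> rcg_edges n s r1 r2 c"
  then show thesis using that(2,3,4,5,7) by (cases rule: rcg_edge_cases) metis+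
qed

text \<open>This and the next facts let class and indices be read off a vertex, which identifies the
  indices produced by \<open>arc_cases\<close> with the given ones.\<close>

lemma hub_eq_iff: "i \<in> {1..s} \<Longrightarrow> j \<in> {1..s} \<Longrightarrow> r1 i = r1 j \<longleftrightarrow> i = j"
  using valid_selectionD(1)[OF sel] by (rule inj_on_eq_iff)

lemma grid_eq_iff:
  assumes "i \<in> {1..s}" "j \<in> {1..s-1}" "k \<in> {1..s}" "l \<in> {1..s-1}"
  shows "r2 i j = r2 k l \<longleftrightarrow> i = k \<and> j = l"
  using assms valid_selectionD(6)[OF sel, of i j k l] inj_onD[OF valid_selectionD(3)[OF sel, of i]]
  by metis

lemma grid_neq_hub: "i \<in> {1..s} \<Longrightarrow> j \<in> {1..s-1} \<Longrightarrow> k \<in> {1..s} \<Longrightarrow> r2 i j \<noteq> r1 k"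
  by (rule valid_selectionD(5)[OF sel])

lemma hub_not_leftover: "i \<in> {1..s} \<Longrightarrow> r1 i \<notin> leftover"
  unfolding unselected_def by blast

lemma grid_not_leftover:
  assumes "i \<in> {1..s}" "j \<in> {1..s-1}"
  shows "r2 i j \<notin> leftover"
  using assms unfolding leftover_eq by blast

text \<open>The bound admits both alternatives of the last construction step at once, which is
  affordable as each set has size \<open>O(s)\<close>.\<close>

lemma neighbours_hub:
  assumes "i \<in> {1..s}"
  shows "parcs G `` {r1 i} \<subseteq> r2 i ` {1..s-1} \<union> leftover \<union> r1 ` {1..s}"
proof
  fix v assume "v \<in> parcs G `` {r1 i}"
  then have "(r1 i, v) \<in> parcs G" by simp
  then show "v \<in> r2 i ` {1..s-1} \<union> leftover \<union> r1 ` {1..s}"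
  proof (cases rule: arc_cases)
    case (hub_grid i' j)
    then have "i' = i" using hub_eq_iff assms by metis
    with hub_grid show ?thesis by blast
  next
    case grid_hub then show ?thesis by blast
  next
    case row then show ?thesis using grid_neq_hub assms by metis
  next
    case column then show ?thesis using grid_neq_hub assms by metis
  qed blast+
qed

lemma neighbours_grid:
  assumes "i \<in> {1..s}" "j \<in> {1..s-1}"
  shows "parcs G `` {r2 i j} \<subseteq> r2 i ` {1..s-1} \<union> (\<lambda>u. r2 u j) ` {1..s} \<union> {r1 i}"
proof
  fix v assume "v \<in> parcs G `` {r2 i j}"
  then have "(r2 i j, v) \<in> parcs G" by simp
  then show "v \<in> r2 i ` {1..s-1} \<union> (\<lambda>u. r2 u j) ` {1..s} \<union> {r1 i}"
  proof (cases rule: arc_cases)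
    case hub_grid then show ?thesis using grid_neq_hub assms by metis
  next
    case (grid_hub i' j')
    then have "i' = i" using grid_eq_iff assms by metis
    with grid_hub show ?thesis by blast
  next
    case (row i' j' k)
    then have "i' = i" using grid_eq_iff assms by metis
    with row show ?thesis by blast
  next
    case (column i' j' k)
    then have "j' = j" using grid_eq_iff assms by metis
    with column show ?thesis by blast
  next
    case hub_leftover then show ?thesis using grid_neq_hub assms by metis
  next
    case leftover_hub then show ?thesis using grid_not_leftover assms by metis
  next
    case hubs then show ?thesis using grid_neq_hub assms by metis
  qed
qed

lemma neighbours_leftover:
  assumes "v \<in> leftover"
  shows "parcs G `` {v} \<subseteq> r1 ` {1..s}"
proof
  fix w assume "w \<in> parcs G `` {v}"
  then have "(v, w) \<in> parcs G" by simp
  then show "w \<in> r1 ` {1..s}"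
    using assms hub_not_leftover grid_not_leftover by (cases rule: arc_cases) blast+
qed

section \<open>The degree bound\<close>

text \<open>Hubs give the largest estimate, \<open>(s - 1) + 2 * s + s\<close>; grid vertices give
  \<open>(s - 1) + s + 1\<close> and leftover regions \<open>s\<close>.\<close>

lemma out_degree_le:
  assumes "v \<in> pverts G"
  shows "out_degree (with_proj G) v \<le> 4 * s"
proof -
  \<comment> \<open>Out-degree counts arcs; pairing with \<open>v\<close> is injective, so it counts
    neighbours.\<close>
  have "out_arcs (with_proj G) v = Pair v ` (parcs G `` {v})"
    by (auto simp: out_arcs_def)
  then have deg: "out_degree (with_proj G) v = card (parcs G `` {v})"
    by (simp add: out_degree_def card_image inj_on_def)
  have fin: "finite leftover" by (simp add: unselected_def)
  have left: "card leftover \<le> 2 * s"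
    using card_leftover floor_sqrt_bounds(3)[OF s] by linarith
  have row: "card (r2 i ` {1..s-1}) \<le> s - 1"
    and col: "card ((\<lambda>u. r2 u j) ` {1..s}) \<le> s" and hubs: "card (r1 ` {1..s}) \<le> s" for i j
    using card_image_le[of "{1..s-1}" "r2 i"] card_image_le[of "{1..s}" "\<lambda>u. r2 u j"]
      card_image_le[of "{1..s}" r1] by simp_all
  \<comment> \<open>Needed for \<open>(s - 1) + 1 = s\<close> under truncated subtraction in the
    grid case.\<close>
  have s_pos: "s \<ge> 1" using c by simp
  from assms have "card (parcs G `` {v}) \<le> 4 * s"
  proof (cases rule: vertex_cases)
    case (hub i)
    have "card (parcs G `` {v}) \<le> card (r2 i ` {1..s-1} \<union> leftover \<union> r1 ` {1..s})"
      unfolding hub(1) using neighbours_hub[OF hub(2)] fin by (intro card_mono) auto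
    also have "\<dots> \<le> card (r2 i ` {1..s-1}) + card leftover + card (r1 ` {1..s})"
      using card_Un_le[of "r2 i ` {1..s-1} \<union> leftover" "r1 ` {1..s}"]
        card_Un_le[of "r2 i ` {1..s-1}" leftover] by linarith
    finally show ?thesis using row[of i] left hubs by linarith
  next
    case (grid i j)
    have "card (parcs G `` {v})
        \<le> card (r2 i ` {1..s-1} \<union> (\<lambda>u. r2 u j) ` {1..s} \<union> {r1 i})"
      unfolding grid(1) using neighbours_grid[OF grid(2,3)] by (intro card_mono) auto
    also have "\<dots> \<le> card (r2 i ` {1..s-1}) + card ((\<lambda>u. r2 u j) ` {1..s}) + card {r1 i}"
      using card_Un_le[of "r2 i ` {1..s-1} \<union> (\<lambda>u. r2 u j) ` {1..s}" "{r1 i}"]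
        card_Un_le[of "r2 i ` {1..s-1}" "(\<lambda>u. r2 u j) ` {1..s}"] by linarith
    finally show ?thesis using row[of i] col[of j] s_pos by simp
  next
    case leftover
    have "card (parcs G `` {v}) \<le> card (r1 ` {1..s})"
      using neighbours_leftover[OF leftover] by (intro card_mono) auto
    then show ?thesis using hubs by linarith
  qed
  then show ?thesis using deg by simp
qed

end

theorem theorem1:
  shows "\<exists>C::real. C > 0 \<and>
    (\<forall>(n::nat) (M::real mat) (G::nat pair_pre_digraph).
       n \<ge> 1 \<and> M \<in> carrier_mat n n \<and> region_connected_graph n M G \<longrightarrow>
         (\<forall>v\<in>pverts G. real (out_degree (with_proj G) v) \<le> C * sqrt (real n)) \<and>
         (\<forall>u\<in>pverts G. \<forall>v\<in>pverts G. graph_distance G u v \<le> 2))"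
\<comment> \<open>The constant is the factor in \<open>out_degree_le\<close>, combined with
  \<open>s \<le> sqrt n\<close>; it is fixed before \<open>n\<close>.\<close>
proof (intro exI[of _ 4] conjI allI impI)
  fix n :: nat and M :: "real mat" and G :: "nat pair_pre_digraph"
  assume "n \<ge> 1 \<and> M \<in> carrier_mat n n \<and> region_connected_graph n M G"
  then obtain r1 r2 c where "rcg_construction n (nat \<lfloor>sqrt (real n)\<rfloor>) c M r1 r2 G"
    by (auto simp: region_connected_graph_def Let_def rcg_construction_def)
  then interpret rcg_construction n "nat \<lfloor>sqrt (real n)\<rfloor>" c M r1 r2 G .
  show "\<forall>v\<in>pverts G. real (out_degree (with_proj G) v) \<le> 4 * sqrt (real n)"
  proof
    fix v assume "v \<in> pverts G"
    then have "real (out_degree (with_proj G) v) \<le> real (4 * nat \<lfloor>sqrt (real n)\<rfloor>)"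
      using out_degree_le of_nat_le_iff by blast
    also have "\<dots> \<le> 4 * sqrt (real n)"
      using floor_sqrt_bounds(1)[OF refl, of n] by simp
    finally show "real (out_degree (with_proj G) v) \<le> 4 * sqrt (real n)" .
  qed
  show "\<forall>u\<in>pverts G. \<forall>v\<in>pverts G. graph_distance G u v \<le> 2"
    using graph_distance_le_2[OF wf] vertices_joined by blast
qed simp

end
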